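(* For positive integers $m$ consider polynomials in $\mathbb R[\mathbf x^{[0]},\mathbf x^{[1]}]$ with $\mathbf x^{[i]}=(x^{[i]}_1,\dots,x^{[i]}_m)$. (i) There exists a sequence of polynomials $(p_m)_{m\ge1}$ with $p_m\in\mathbb R[x^{[0]}_1,\dots,x^{[0]}_m,x^{[1]}_1,\dots,x^{[1]}_m]$ such that $$\operatorname{rank}_{\Lambda_1}(p_m)=3,\qquad\operatorname{sos-rank}_{\Lambda_1}(p_m)=2\qquad\text{and}\qquad\log_2(m)\le\operatorname{sep-rank}_{\Lambda_1}(p_m)<\infty .$$ (ii) There exists a sequence of polynomials $(p_m)_{m\ge1}$ with $p_m\in\mathbb R[x^{[0]}_1,\dots,x^{[0]}_m,x^{[1]}_1,\dots,x^{[1]}_m]$ such that $\operatorname{rank}_{\Lambda_1}(p_m)=3$, $\operatorname{sos-rank}_{\Lambda_1}(p_m)<\infty$ for all $m$, and $$\lim_{m\to\infty}\operatorname{sos-rank}_{\Lambda_1}(p_m)=\infty .$$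
   Context: $\Lambda_1$ is the simple edge (the simplicial complex on $\{0,1\}$ whose only facet is $\{0,1\}$), without any group action. For $p\in\mathbb R[\mathbf x^{[0]},\mathbf x^{[1]}]$ the ranks are the following (each is $\infty$ if no such decomposition exists): - $\operatorname{rank}_{\Lambda_1}(p)$ is the smallest $r$ such that $p=\sum_{\alpha=1}^rp^{[0]}_\alpha(\mathbf x^{[0]})\,p^{[1]}_\alpha(\mathbf x^{[1]})$ with $p^{[i]}_\alpha\in\mathbb R[\mathbf x^{[i]}]$. - $\operatorname{sep-rank}_{\Lambda_1}(p)$ is the smallest $r$ such that there is such a decomposition in which every $p^{[i]}_\alpha$ is a sum of squares in $\mathbb R[\mathbf x^{[i]}]$. - $\operatorname{sos-rank}_{\Lambda_1}(p)$ is the smallest $r$ for which there are finite sets $\mathcal S_0,\mathcal S_1$ and polynomials $q^{[i]}_{k,\alpha}\in\mathbb R[\mathbf x^{[i]}]$ ($i\in\{0,1\}$, $k\in\mathcal S_i$, $\alpha\in\{1,\dots,r\}$) such that $$p=\sum_{k_0\in\mathcal S_0,\,k_1\in\mathcal S_1}\Big(\sum_{\alpha=1}^rq^{[0]}_{k_0,\alpha}(\mathbf x^{[0]})\,q^{[1]}_{k_1,\alpha}(\mathbf x^{[1]})\Big)^2 .$$ *)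

theory Defs
  imports Complex_Main "HOL-Library.Poly_Mapping" "HOL-Library.Extended_Real"
begin

text \<open>
  \<^term>\<open>X i j\<close> stands for the variable $x^{[i]}_j$. Monomials are finitely supported exponent
  functions, and polynomials are finitely supported coefficient functions on monomials, with the
  convolution product of \<^theory>\<open>HOL-Library.Poly_Mapping\<close>.
\<close>

datatype var = X nat nat

type_synonym monomial = "var \<Rightarrow>\<^sub>0 nat"

type_synonym rpoly = "monomial \<Rightarrow>\<^sub>0 real"

definition poly_ring :: "var set \<Rightarrow> rpoly set" where
  "poly_ring V = {p. \<forall>t \<in> Poly_Mapping.keys p. Poly_Mapping.keys t \<subseteq> V}"

definition block :: "nat \<Rightarrow> nat \<Rightarrow> var set" where
  "block m i = X i ` {1..m}"

definition sums_of_squares :: "var set \<Rightarrow> rpoly set" where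
  "sums_of_squares V =
     {p. \<exists>(n::nat) q. (\<forall>k<n. q k \<in> poly_ring V) \<and> p = (\<Sum>k<n. (q k)\<^sup>2)}"

text \<open>
  The three ranks for the simple edge, for polynomials in two blocks of \<open>m\<close> variables.
  The infimum in \<^typ>\<open>enat\<close> is the minimum of a nonempty set and \<open>\<infinity>\<close> for the empty set.
  In each decomposition the factor at vertex \<open>i\<close> only uses the variables of block \<open>i\<close>.
\<close>

definition edge_rank :: "nat \<Rightarrow> rpoly \<Rightarrow> enat" where
  "edge_rank m p = Inf {enat r | r.
     \<exists>f0 f1 :: nat \<Rightarrow> rpoly.
       (\<forall>\<alpha>\<in>{1..r}. f0 \<alpha> \<in> poly_ring (block m 0) \<and> f1 \<alpha> \<in> poly_ring (block m 1)) \<and>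
       p = (\<Sum>\<alpha>=1..r. f0 \<alpha> * f1 \<alpha>)}"

definition edge_sep_rank :: "nat \<Rightarrow> rpoly \<Rightarrow> enat" where
  "edge_sep_rank m p = Inf {enat r | r.
     \<exists>f0 f1 :: nat \<Rightarrow> rpoly.
       (\<forall>\<alpha>\<in>{1..r}. f0 \<alpha> \<in> sums_of_squares (block m 0) \<and> f1 \<alpha> \<in> sums_of_squares (block m 1)) \<and>
       p = (\<Sum>\<alpha>=1..r. f0 \<alpha> * f1 \<alpha>)}"

text \<open>The finite index sets of the squares are taken, without loss of generality, inside \<^typ>\<open>nat\<close>.\<close>

definition edge_sos_rank :: "nat \<Rightarrow> rpoly \<Rightarrow> enat" where
  "edge_sos_rank m p = Inf {enat r | r.
     \<exists>(S0 :: nat set) (S1 :: nat set) (q0 :: nat \<Rightarrow> nat \<Rightarrow> rpoly) (q1 :: nat \<Rightarrow> nat \<Rightarrow> rpoly).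
       finite S0 \<and> finite S1 \<and>
       (\<forall>k\<in>S0. \<forall>\<alpha>\<in>{1..r}. q0 k \<alpha> \<in> poly_ring (block m 0)) \<and>
       (\<forall>k\<in>S1. \<forall>\<alpha>\<in>{1..r}. q1 k \<alpha> \<in> poly_ring (block m 1)) \<and>
       p = (\<Sum>k0\<in>S0. \<Sum>k1\<in>S1. (\<Sum>\<alpha>=1..r. q0 k0 \<alpha> * q1 k1 \<alpha>)\<^sup>2)}"

end

theory Submission
  imports Defs "HOL-Computational_Algebra.Polynomial"
begin

text \<open>
  Lower bounds only need the two variables $x = x^{[0]}_1$ and $y = x^{[1]}_1$, so all other variables
  are set to zero and polynomials are mapped to \<^typ>\<open>real poly poly\<close>.

  (i) The polynomial $\sum_{i,j<n} (i-j)^2 L_i(x)^2 L_j(y)^2$, with $L_i$ the Lagrange polynomials of the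
  nodes $0,\dots,n-1$, takes on the nodes the entries, up to positive row and column scalings, of the distance
  matrix $(i-j)^2$, which has rank 3, positive semidefinite rank 2 and nonnegative rank at least
  $\log_2 n$ because of its zero pattern.

  (ii) The AM-GM form $x^{2d} - 2d\,x y^{2d-1} + (2d-1) y^{2d}$ with $d$ a power of two is a sum of
  squares by iterated use of $x^{2e} = (x^e - y^e)^2 + 2 x^e y^e - y^{2e}$. In any representation by
  squares of $h = \sum_{\alpha\le r} q^{[0]}_\alpha q^{[1]}_\alpha$ every $h$ is homogeneous of degree
  $d$. Hence the coefficient vectors of the $q^{[0]}$ at $x^i$ and of the $q^{[1]}$ at $y^{d-j}$ are
  orthogonal unless $i = j$, so that at most $r$ powers $x^i$ occur in the $h$. On the other hand
  $x^1$ occurs, and if $x^i$ with $0 < i < d$ occurs, then so does some $x^k$ with $i < k \le 2i$,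
  since otherwise $x^{2i} y^{2d-2i}$ has a positive coefficient in the sum of squares. Therefore
  $r \ge \log_2 d$.
\<close>

section \<open>Constants, variables and closure of the polynomial rings\<close>

definition const :: "real \<Rightarrow> rpoly" where
  "const c = Poly_Mapping.single 0 c"

definition indet :: "var \<Rightarrow> rpoly" where
  "indet v = Poly_Mapping.single (Poly_Mapping.single v 1) 1"

lemma const_mult: "const (a * b) = const a * const b"
  by (simp add: const_def mult_single)

lemma const_add: "const (a + b) = const a + const b"
  by (simp add: const_def single_add)

lemma const_of_nat: "const (of_nat n) = of_nat n"
  by (induction n) (simp_all add: const_add, simp_all add: const_def)

lemma const_in_poly_ring [simp]: "const c \<in> poly_ring V"
  by (auto simp: poly_ring_def const_def)

lemma of_nat_in_poly_ring [simp]: "of_nat n \<in> poly_ring V"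
  using const_in_poly_ring[of "of_nat n"] by (simp only: const_of_nat)

lemma zero_in_poly_ring [simp]: "0 \<in> poly_ring V"
  using of_nat_in_poly_ring[of 0] by simp

lemma one_in_poly_ring [simp]: "1 \<in> poly_ring V"
  using of_nat_in_poly_ring[of 1] by simp

lemma indet_in_poly_ring: "v \<in> V \<Longrightarrow> indet v \<in> poly_ring V"
  by (auto simp: poly_ring_def indet_def)

lemma poly_ring_mono: "V \<subseteq> W \<Longrightarrow> p \<in> poly_ring V \<Longrightarrow> p \<in> poly_ring W"
  by (auto simp: poly_ring_def)

lemma add_in_poly_ring: "p \<in> poly_ring V \<Longrightarrow> q \<in> poly_ring V \<Longrightarrow> p + q \<in> poly_ring V"
  using Poly_Mapping.keys_add[of p q] by (auto simp: poly_ring_def)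

lemma uminus_in_poly_ring: "p \<in> poly_ring V \<Longrightarrow> - p \<in> poly_ring V"
  by (auto simp: poly_ring_def)

lemma diff_in_poly_ring: "p \<in> poly_ring V \<Longrightarrow> q \<in> poly_ring V \<Longrightarrow> p - q \<in> poly_ring V"
  using add_in_poly_ring[of p V "- q"] by (simp add: uminus_in_poly_ring)

lemma mult_in_poly_ring:
  assumes "p \<in> poly_ring V" "q \<in> poly_ring V"
  shows "p * q \<in> poly_ring V"
  unfolding poly_ring_def
proof (intro CollectI ballI)
  fix t assume "t \<in> Poly_Mapping.keys (p * q)"
  then obtain a b where "a \<in> Poly_Mapping.keys p" "b \<in> Poly_Mapping.keys q" "t = a + b"
    using keys_mult[of p q] by blast
  with assms show "Poly_Mapping.keys t \<subseteq> V"
    using Poly_Mapping.keys_add[of a b] by (fastforce simp: poly_ring_def)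
qed

lemma power_in_poly_ring: "p \<in> poly_ring V \<Longrightarrow> p ^ n \<in> poly_ring V"
  by (induction n) (auto intro: mult_in_poly_ring)

lemma sum_in_poly_ring: "(\<And>i. i \<in> A \<Longrightarrow> f i \<in> poly_ring V) \<Longrightarrow> sum f A \<in> poly_ring V"
  by (induction A rule: infinite_finite_induct) (auto intro: add_in_poly_ring)

lemma prod_in_poly_ring: "(\<And>i. i \<in> A \<Longrightarrow> f i \<in> poly_ring V) \<Longrightarrow> prod f A \<in> poly_ring V"
  by (induction A rule: infinite_finite_induct) (auto intro: mult_in_poly_ring)

lemmas poly_ring_closed = add_in_poly_ring uminus_in_poly_ring diff_in_poly_ring mult_in_poly_ring
  power_in_poly_ring sum_in_poly_ring prod_in_poly_ring const_in_poly_ring of_nat_in_poly_ring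
  zero_in_poly_ring one_in_poly_ring

section \<open>The specialization homomorphism to two variables\<close>

definition var_img :: "var \<Rightarrow> real poly poly" where
  "var_img v = (if v = X 0 1 then [:[:0, 1:]:] else if v = X 1 1 then [:0, 1:] else 0)"

definition mon_img :: "monomial \<Rightarrow> real poly poly" where
  "mon_img t = (\<Prod>v\<in>Poly_Mapping.keys t. var_img v ^ Poly_Mapping.lookup t v)"

text \<open>The outer polynomial variable is $y$, the inner one $x$.\<close>

definition bipoly :: "rpoly \<Rightarrow> real poly poly" where
  "bipoly p = (\<Sum>t\<in>Poly_Mapping.keys p. [:[:Poly_Mapping.lookup p t:]:] * mon_img t)"

text \<open>Extra variables have exponent zero and contribute factors 1, so several monomials can be
  compared over one common index set.\<close>

lemma mon_img_superset:
  assumes "finite K" "Poly_Mapping.keys t \<subseteq> K"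
  shows "mon_img t = (\<Prod>v\<in>K. var_img v ^ Poly_Mapping.lookup t v)"
  unfolding mon_img_def using assms
  by (intro prod.mono_neutral_left) (auto simp: in_keys_iff)

lemma mon_img_add: "mon_img (s + t) = mon_img s * mon_img t"
proof -
  let ?K = "Poly_Mapping.keys s \<union> Poly_Mapping.keys t"
  have "mon_img (s + t) = (\<Prod>v\<in>?K. var_img v ^ Poly_Mapping.lookup (s + t) v)"
    using Poly_Mapping.keys_add[of s t] by (intro mon_img_superset) auto
  also have "\<dots> = mon_img s * mon_img t"
    by (subst (1 2) mon_img_superset[of ?K])
      (auto simp: lookup_add power_add prod.distrib)
  finally show ?thesis .
qed

lemma bipoly_superset:
  assumes "finite K" "Poly_Mapping.keys p \<subseteq> K"
  shows "bipoly p = (\<Sum>t\<in>K. [:[:Poly_Mapping.lookup p t:]:] * mon_img t)"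
  unfolding bipoly_def using assms
  by (intro sum.mono_neutral_left) (auto simp: in_keys_iff)

lemma bipoly_add [simp]: "bipoly (p + q) = bipoly p + bipoly q"
proof -
  let ?K = "Poly_Mapping.keys p \<union> Poly_Mapping.keys q"
  have "bipoly (p + q) = (\<Sum>t\<in>?K. [:[:Poly_Mapping.lookup (p + q) t:]:] * mon_img t)"
    using Poly_Mapping.keys_add[of p q] by (intro bipoly_superset) auto
  also have "\<dots> = (\<Sum>t\<in>?K. [:[:Poly_Mapping.lookup p t:]:] * mon_img t
                     + [:[:Poly_Mapping.lookup q t:]:] * mon_img t)"
    by (intro sum.cong refl) (simp add: lookup_add flip: smult_add_left)
  also have "\<dots> = bipoly p + bipoly q"
    by (subst (1 2) bipoly_superset[of ?K]) (auto simp: sum.distrib)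
  finally show ?thesis .
qed

lemma bipoly_0 [simp]: "bipoly 0 = 0"
  by (simp add: bipoly_def)

lemma bipoly_sum [simp]: "bipoly (sum f A) = (\<Sum>i\<in>A. bipoly (f i))"
  by (induction A rule: infinite_finite_induct) auto

lemma bipoly_single: "bipoly (Poly_Mapping.single t c) = [:[:c:]:] * mon_img t"
  by (simp add: bipoly_def)

text \<open>Decomposition into terms, by which multiplicativity of \<open>bipoly\<close> reduces to
  products of single terms.\<close>

lemma rpoly_sum_single:
  "(\<Sum>t\<in>Poly_Mapping.keys p. Poly_Mapping.single t (Poly_Mapping.lookup p t)) = p"
proof (rule poly_mapping_eqI)
  fix s
  show "Poly_Mapping.lookup (\<Sum>t\<in>Poly_Mapping.keys p. Poly_Mapping.single t (Poly_Mapping.lookup p t)) s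
      = Poly_Mapping.lookup p s"
    by (simp add: lookup_sum lookup_single when_def in_keys_iff)
qed

lemma bipoly_mult [simp]: "bipoly (p * q) = bipoly p * bipoly q"
proof -
  let ?s = "\<lambda>p t. Poly_Mapping.single t (Poly_Mapping.lookup p t) :: rpoly"
  have "bipoly (p * q) = bipoly ((\<Sum>s\<in>Poly_Mapping.keys p. ?s p s) * (\<Sum>t\<in>Poly_Mapping.keys q. ?s q t))"
    by (simp only: rpoly_sum_single)
  also have "\<dots> = (\<Sum>s\<in>Poly_Mapping.keys p. \<Sum>t\<in>Poly_Mapping.keys q. bipoly (?s p s * ?s q t))"
    by (simp only: sum_product bipoly_sum)
  also have "\<dots> = (\<Sum>s\<in>Poly_Mapping.keys p. \<Sum>t\<in>Poly_Mapping.keys q.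
      ([:[:Poly_Mapping.lookup p s:]:] * mon_img s) * ([:[:Poly_Mapping.lookup q t:]:] * mon_img t))"
    by (intro sum.cong refl) (simp add: mult_single bipoly_single mon_img_add mult_ac)
  also have "\<dots> = bipoly p * bipoly q"
    by (simp only: bipoly_def sum_product)
  finally show ?thesis .
qed

lemma bipoly_const: "bipoly (const c) = [:[:c:]:]"
  by (simp add: const_def bipoly_single mon_img_def)

lemma bipoly_of_nat [simp]: "bipoly (of_nat n) = of_nat n"
  by (metis bipoly_const const_of_nat of_nat_poly)

lemma bipoly_1 [simp]: "bipoly 1 = 1"
  using bipoly_of_nat[of 1] by simp

lemma bipoly_uminus [simp]: "bipoly (- p) = - bipoly p"
  by (metis bipoly_0 bipoly_add add.right_inverse add_eq_0_iff)

lemma bipoly_diff [simp]: "bipoly (p - q) = bipoly p - bipoly q"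
  using bipoly_add[of p "- q"] by simp

lemma bipoly_power [simp]: "bipoly (p ^ n) = bipoly p ^ n"
  by (induction n) auto

lemma bipoly_prod [simp]: "bipoly (prod f A) = (\<Prod>i\<in>A. bipoly (f i))"
  by (induction A rule: infinite_finite_induct) auto

lemma bipoly_indet [simp]: "bipoly (indet v) = var_img v"
  by (simp add: indet_def bipoly_single mon_img_def flip: one_pCons)

text \<open>The image is built from constants and images of variables by sums and products alone.
  With \<open>R\<close> the polynomials free of \<open>y\<close>, or those free of \<open>x\<close>,
  this locates the images of the two blocks.\<close>

lemma bipoly_in_subring:
  assumes "p \<in> poly_ring V" "\<And>v. v \<in> V \<Longrightarrow> var_img v \<in> R"
    "\<And>c. [:[:c:]:] \<in> R"
    "\<And>f g. f \<in> R \<Longrightarrow> g \<in> R \<Longrightarrow> f + g \<in> R"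
    "\<And>f g. f \<in> R \<Longrightarrow> g \<in> R \<Longrightarrow> f * g \<in> R"
  shows "bipoly p \<in> R"
proof -
  have 0: "0 \<in> R" and 1: "1 \<in> R" using assms(3)[of 0] assms(3)[of 1] by (auto simp: one_pCons)
  have pw: "f ^ n \<in> R" if "f \<in> R" for f n
    by (induction n) (auto simp: 1 that assms(5))
  have pr: "prod f A \<in> R" if "\<And>v. v \<in> A \<Longrightarrow> f v \<in> R" for f :: "var \<Rightarrow> _" and A
    using that by (induction A rule: infinite_finite_induct) (auto simp: 1 assms(5))
  have sm: "sum f A \<in> R" if "\<And>v. v \<in> A \<Longrightarrow> f v \<in> R" for f :: "monomial \<Rightarrow> _" and A
    using that by (induction A rule: infinite_finite_induct) (auto simp: 0 assms(4))
  show ?thesis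
    unfolding bipoly_def mon_img_def
    using assms(1) by (intro sm assms(5) assms(3) pr pw assms(2)) (auto simp: poly_ring_def)
qed

lemma bipoly_block0:
  assumes "p \<in> poly_ring (block m 0)"
  obtains u where "bipoly p = [:u:]"
proof -
  have "bipoly p \<in> range (\<lambda>u. [:u:])"
  proof (rule bipoly_in_subring[OF assms], goal_cases)
    case (1 v) then show ?case by (auto simp: var_img_def block_def intro: image_eqI[of _ _ 0])
  next
    case (3 f g) then show ?case by auto
  next
    case (4 f g) then show ?case by auto
  qed auto
  then show thesis using that by auto
qed

text \<open>The image is free of \<open>x\<close>; since \<open>x\<close> is the inner variable,
  this is expressed through the coefficients.\<close>

lemma bipoly_block1:
  assumes "p \<in> poly_ring (block m 1)"
  shows "degree (coeff (bipoly p) j) = 0"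
proof -
  have "bipoly p \<in> {G. \<forall>j. degree (coeff G j) = 0}"
  proof (rule bipoly_in_subring[OF assms], goal_cases)
    case (1 v) then show ?case by (auto simp: var_img_def block_def coeff_pCons split: nat.split)
  next
    case (2 c) then show ?case by (auto simp: coeff_pCons split: nat.split)
  next
    case (3 f g) then show ?case by (auto simp: intro!: le_antisym[OF degree_add_le])
  next
    case (4 f g)
    then show ?case
      by (auto simp: coeff_mult degree_mult_eq_0 intro!: le_antisym[OF degree_sum_le] order_trans[OF degree_mult_le])
  qed
  then show ?thesis by auto
qed

text \<open>A factor in \<open>x\<close> times a factor in \<open>y\<close> has a coefficient matrix
  of rank one. Coefficients of a sum of such products thereby become inner products over the
  summands.\<close>

lemma coeff_bipoly_mult:
  assumes "f \<in> poly_ring (block m 0)" "g \<in> poly_ring (block m 1)"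
  shows "coeff (coeff (bipoly (f * g)) j) i
    = coeff (coeff (bipoly f) 0) i * coeff (coeff (bipoly g) j) 0"
proof -
  obtain u where u: "bipoly f = [:u:]" using bipoly_block0[OF assms(1)] .
  obtain c where c: "coeff (bipoly g) j = [:c:]"
    using bipoly_block1[OF assms(2)] degree_eq_zeroE by blast
  show ?thesis by (simp add: u c)
qed

section \<open>Evaluation at real points\<close>

definition ev :: "rpoly \<Rightarrow> real \<Rightarrow> real \<Rightarrow> real" where
  "ev p a b = poly (poly (bipoly p) [:b:]) a"

lemma ev_simps [simp]:
  "ev (p + q) a b = ev p a b + ev q a b" "ev (p - q) a b = ev p a b - ev q a b"
  "ev (- p) a b = - ev p a b"
  "ev (p * q) a b = ev p a b * ev q a b" "ev (p ^ n) a b = ev p a b ^ n"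
  "ev 0 a b = 0" "ev 1 a b = 1" "ev (of_nat n) a b = of_nat n"
  "ev (indet (X 0 1)) a b = a" "ev (indet (X 1 1)) a b = b"
  by (simp_all add: ev_def var_img_def)

lemma ev_sum [simp]: "ev (sum f A) a b = (\<Sum>i\<in>A. ev (f i) a b)"
  by (simp add: ev_def poly_sum)

lemma ev_prod [simp]: "ev (prod f A) a b = (\<Prod>i\<in>A. ev (f i) a b)"
  by (simp add: ev_def poly_prod)

text \<open>The second argument is a dummy for factors at vertex 0; the lower bounds below set it to
  0.\<close>

lemma ev_block0: "f \<in> poly_ring (block m 0) \<Longrightarrow> ev f a b = ev f a b'"
  by (erule bipoly_block0) (simp add: ev_def)

lemma ev_block1:
  assumes "g \<in> poly_ring (block m 1)"
  shows "ev g a b = ev g a' b"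
proof -
  \<comment> \<open>Evaluation at the constant \<open>[:b:]\<close> only combines coefficients that
    are constant in \<open>x\<close>.\<close>
  have "degree (poly (bipoly g) [:b:]) = 0"
    unfolding poly_altdef using bipoly_block1[OF assms]
    by (intro le_antisym[OF degree_sum_le] order_trans[OF degree_mult_le]) 
      (auto simp: poly_const_pow)
  then obtain c where "poly (bipoly g) [:b:] = [:c:]" by (metis degree_eq_zeroE)
  then show ?thesis by (simp add: ev_def)
qed


section \<open>Lower bounds from the sign pattern of a distance matrix\<close>

definition off_diagonal :: "rpoly \<Rightarrow> nat \<Rightarrow> (nat \<Rightarrow> real) \<Rightarrow> bool" where
  "off_diagonal p n x \<longleftrightarrow>
     (\<forall>i<n. ev p (x i) (x i) = 0) \<and> (\<forall>i<n. \<forall>j<n. i \<noteq> j \<longrightarrow> ev p (x i) (x j) > 0)"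

text \<open>At most two products give a matrix of values of rank at most two, with vanishing 3 x 3
  determinant. With zero diagonal this determinant is the sum of two cyclic products, both positive
  here.\<close>

lemma edge_rank_ge:
  assumes "off_diagonal p 3 x"
  shows "edge_rank m p \<ge> 3"
  unfolding edge_rank_def
proof (rule Inf_greatest, elim CollectE exE conjE)
  fix z r f0 f1
  assume z: "z = enat r" and r: "\<forall>\<alpha>\<in>{1..r}. f0 \<alpha> \<in> poly_ring (block m 0) \<and> f1 \<alpha> \<in> poly_ring (block m 1)"
    and p: "p = (\<Sum>\<alpha>=1..r. f0 \<alpha> * f1 \<alpha>)"
  show "3 \<le> z"
    unfolding z
  proof (rule ccontr)
    assume "\<not> 3 \<le> enat r"
    then have "r \<le> 2" by (metis enat_ord_simps(1) not_less_eq_eq numeral_2_eq_2 numeral_3_eq_3 numeral_eq_enat)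
    \<comment> \<open>Padding by zero turns \<open>r \<le> 2\<close> summands into exactly
      two.\<close>
    define F G where "F = (\<lambda>\<alpha> i. if \<alpha> \<le> r then ev (f0 \<alpha>) (x i) 0 else 0)"
      and "G = (\<lambda>\<alpha> j. if \<alpha> \<le> r then ev (f1 \<alpha>) 0 (x j) else 0)"
    define M where "M = (\<lambda>i j. ev p (x i) (x j))"
    have "M i j = (\<Sum>\<alpha>=1..r. F \<alpha> i * G \<alpha> j)" for i j
      unfolding p M_def ev_sum
    proof (intro sum.cong)
      fix \<alpha> assume "\<alpha> \<in> {1..r}"
      then show "ev (f0 \<alpha> * f1 \<alpha>) (x i) (x j) = F \<alpha> i * G \<alpha> j"
        using r ev_block0[of "f0 \<alpha>" m "x i" "x j" 0] ev_block1[of "f1 \<alpha>" m "x i" "x j" 0]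
        by (auto simp: F_def G_def)
    qed auto
    also have "\<dots> i j = (\<Sum>\<alpha>\<in>{1,2}. F \<alpha> i * G \<alpha> j)" for i j
      using \<open>r \<le> 2\<close> by (intro sum.mono_neutral_left) (auto simp: F_def G_def)
    finally have M: "M i j = F 1 i * G 1 j + F 2 i * G 2 j" for i j
      by simp
    have "M 0 0 * (M 1 1 * M 2 2 - M 1 2 * M 2 1) - M 0 1 * (M 1 0 * M 2 2 - M 1 2 * M 2 0)
        + M 0 2 * (M 1 0 * M 2 1 - M 1 1 * M 2 0) = 0"
      unfolding M by algebra
    moreover have "M 0 0 = 0" "M 1 1 = 0" "M 2 2 = 0"
      using assms by (auto simp: off_diagonal_def M_def)
    ultimately have "M 0 1 * M 1 2 * M 2 0 + M 0 2 * M 1 0 * M 2 1 = 0"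
      by (simp add: algebra_simps)
    moreover have "M 0 1 > 0" "M 0 2 > 0" "M 1 0 > 0" "M 1 2 > 0" "M 2 0 > 0" "M 2 1 > 0"
      using assms by (auto simp: off_diagonal_def M_def)
    ultimately show False
      by (metis add_pos_pos less_irrefl mult_pos_pos)
  qed
qed

lemma edge_rank_le_3:
  assumes "f1 \<in> poly_ring (block m 0)" "f2 \<in> poly_ring (block m 0)" "f3 \<in> poly_ring (block m 0)"
    and "g1 \<in> poly_ring (block m 1)" "g2 \<in> poly_ring (block m 1)" "g3 \<in> poly_ring (block m 1)"
    and "p = f1 * g1 + f2 * g2 + f3 * g3"
  shows "edge_rank m p \<le> 3"
proof -
  define f where "f = (\<lambda>\<alpha>::nat. if \<alpha> = 1 then f1 else if \<alpha> = 2 then f2 else f3)"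
  define g where "g = (\<lambda>\<alpha>::nat. if \<alpha> = 1 then g1 else if \<alpha> = 2 then g2 else g3)"
  have "p = (\<Sum>\<alpha>=1..3. f \<alpha> * g \<alpha>)"
    using assms(7) by (simp add: f_def g_def eval_nat_numeral)
  moreover have "f \<alpha> \<in> poly_ring (block m 0)" "g \<alpha> \<in> poly_ring (block m 1)" for \<alpha>
    using assms(1-6) by (simp_all add: f_def g_def)
  ultimately show ?thesis
    unfolding edge_rank_def numeral_eq_enat
    by (intro Inf_lower CollectI exI[of _ 3] exI[of _ f] exI[of _ g] conjI refl) auto
qed

text \<open>For \<open>r = 1\<close> the double sum of squares factors, so the values form a matrix
  \<open>F i * G j\<close>; there a zero diagonal entry forces its whole row or column to
  vanish.\<close>

lemma edge_sos_rank_ge: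
  assumes "off_diagonal p 2 x"
  shows "edge_sos_rank m p \<ge> 2"
  unfolding edge_sos_rank_def
proof (rule Inf_greatest, elim CollectE exE conjE)
  fix z r S0 S1 q0 q1
  assume z: "z = enat r" and fin: "finite S0" "finite S1"
    and q0: "\<forall>k\<in>S0. \<forall>\<alpha>\<in>{1..r}. q0 k \<alpha> \<in> poly_ring (block m 0)"
    and q1: "\<forall>k\<in>S1. \<forall>\<alpha>\<in>{1..r}. q1 k \<alpha> \<in> poly_ring (block m 1)"
    and p: "p = (\<Sum>k0\<in>S0. \<Sum>k1\<in>S1. (\<Sum>\<alpha>=1..r. q0 k0 \<alpha> * q1 k1 \<alpha>)\<^sup>2)"
  show "2 \<le> z"
    unfolding z
  proof (rule ccontr)
    assume "\<not> 2 \<le> enat r"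
    then have "r \<le> 1" by (metis enat_ord_simps(1) not_less_eq_eq numeral_2_eq_2 numeral_eq_enat One_nat_def)
    then consider "r = 0" | "r = 1" by linarith
    then have "\<exists>F G. \<forall>i j. ev p (x i) (x j) = F i * G j"
    proof cases
      case 1
      then have "ev p (x i) (x j) = 0 * 0" for i j by (simp add: p)
      then show ?thesis by (intro exI[of _ "\<lambda>_. 0"]) simp
    next
      case 2
      have "ev p (x i) (x j) = (\<Sum>k\<in>S0. (ev (q0 k 1) (x i) 0)\<^sup>2) * (\<Sum>k\<in>S1. (ev (q1 k 1) 0 (x j))\<^sup>2)" for i j
        unfolding sum_product p ev_sum
      proof (intro sum.cong refl)
        fix k l assume "k \<in> S0" "l \<in> S1"
        then show "ev ((\<Sum>\<alpha>=1..r. q0 k \<alpha> * q1 l \<alpha>)\<^sup>2) (x i) (x j)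
            = (ev (q0 k 1) (x i) 0)\<^sup>2 * (ev (q1 l 1) 0 (x j))\<^sup>2"
          using 2 q0 q1 ev_block0[of "q0 k 1" m "x i" "x j" 0] ev_block1[of "q1 l 1" m "x i" "x j" 0]
          by (auto simp: power_mult_distrib)
      qed
      then show ?thesis by (intro exI[of _ "\<lambda>i. \<Sum>k\<in>S0. (ev (q0 k 1) (x i) 0)\<^sup>2"]
            exI[of _ "\<lambda>j. \<Sum>k\<in>S1. (ev (q1 k 1) 0 (x j))\<^sup>2"]) blast
    qed
    then obtain F G where FG: "\<And>i j. ev p (x i) (x j) = F i * G j" by metis
    have "F 0 * G 0 = 0" "F 0 * G 1 > 0" "F 1 * G 0 > 0"
      using assms by (auto simp: off_diagonal_def simp flip: FG)
    then show False by auto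
  qed
qed

lemma ev_sum_of_squares_nonneg:
  assumes "f \<in> sums_of_squares V"
  shows "ev f a b \<ge> 0"
  using assms by (auto simp: sums_of_squares_def intro!: sum_nonneg)

lemma sums_of_squares_in_poly_ring: "f \<in> sums_of_squares V \<Longrightarrow> f \<in> poly_ring V"
  unfolding sums_of_squares_def
  by (auto intro!: poly_ring_closed)

text \<open>
  The sets of summands that are positive at the \<open>i\<close>-th node in the first variable form an antichain.
\<close>

lemma edge_sep_rank_ge:
  assumes off: "off_diagonal p n x" and n: "2 ^ s \<le> n"
  shows "edge_sep_rank m p \<ge> enat s"
  unfolding edge_sep_rank_def
proof (rule Inf_greatest, elim CollectE exE conjE)
  fix z r f0 f1
  assume z: "z = enat r" and r: "\<forall>\<alpha>\<in>{1..r}. f0 \<alpha> \<in> sums_of_squares (block m 0) \<and> f1 \<alpha> \<in> sums_of_squares (block m 1)"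
    and p: "p = (\<Sum>\<alpha>=1..r. f0 \<alpha> * f1 \<alpha>)"
  define F G where "F = (\<lambda>\<alpha> i. ev (f0 \<alpha>) (x i) 0)" and "G = (\<lambda>\<alpha> j. ev (f1 \<alpha>) 0 (x j))"
  have FG: "F \<alpha> i \<ge> 0" "G \<alpha> i \<ge> 0" if "\<alpha> \<in> {1..r}" for \<alpha> i
    using r that by (auto simp: F_def G_def intro!: ev_sum_of_squares_nonneg)
  have M: "ev p (x i) (x j) = (\<Sum>\<alpha>=1..r. F \<alpha> i * G \<alpha> j)" for i j
    unfolding p ev_sum
  proof (intro sum.cong)
    fix \<alpha> assume "\<alpha> \<in> {1..r}"
    then show "ev (f0 \<alpha> * f1 \<alpha>) (x i) (x j) = F \<alpha> i * G \<alpha> j"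
      using r ev_block0[of "f0 \<alpha>" m "x i" "x j" 0] ev_block1[of "f1 \<alpha>" m "x i" "x j" 0]
      by (auto simp: F_def G_def sums_of_squares_in_poly_ring)
  qed auto
  define S where "S = (\<lambda>i. {\<alpha>\<in>{1..r}. F \<alpha> i > 0})"
  \<comment> \<open>If \<open>S i = S j\<close>, then a summand positive at \<open>(i, j)\<close> is
    positive at \<open>(j, j)\<close> as well, against the zero diagonal. Hence the \<open>n\<close>
    nodes give distinct subsets of \<open>{1..r}\<close>.\<close>
  have "inj_on S {..<n}"
  proof (rule inj_onI, rule ccontr)
    fix i j assume ij: "i \<in> {..<n}" "j \<in> {..<n}" "S i = S j" "i \<noteq> j"
    then have "(\<Sum>\<alpha>=1..r. F \<alpha> i * G \<alpha> j) > 0" and 0: "(\<Sum>\<alpha>=1..r. F \<alpha> j * G \<alpha> j) = 0"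
      using off unfolding M[symmetric] by (auto simp: off_diagonal_def)
    then obtain \<alpha> where \<alpha>: "\<alpha> \<in> {1..r}" "F \<alpha> i * G \<alpha> j > 0"
      by (meson not_le sum_nonpos)
    then have "F \<alpha> i > 0" "G \<alpha> j > 0"
      using FG[OF \<alpha>(1)] by (metis less_eq_real_def mult_zero_left mult_zero_right less_irrefl)+
    then have "\<alpha> \<in> S j" using \<alpha> ij(3) by (auto simp: S_def)
    then have "F \<alpha> j * G \<alpha> j > 0" using \<open>G \<alpha> j > 0\<close> by (simp add: S_def)
    moreover have "F \<alpha> j * G \<alpha> j = 0"
      using 0 \<alpha>(1) FG by (subst (asm) sum_nonneg_eq_0_iff) auto
    ultimately show False by simp
  qed
  moreover have "S ` {..<n} \<subseteq> Pow {1..r}" unfolding S_def by blast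
  ultimately have "card {..<n} \<le> card (Pow {1..r})" by (rule card_inj_on_le) simp
  then have "(2::nat) ^ s \<le> 2 ^ r" using n by (simp add: card_Pow del: power_increasing_iff)
  then show "enat s \<le> z" by (simp add: z)
qed

section \<open>The polynomial of the Euclidean distance matrix\<close>

definition lagrange :: "nat \<Rightarrow> var \<Rightarrow> nat \<Rightarrow> rpoly" where
  "lagrange n v i = (\<Prod>j\<in>{..<n} - {i}. indet v - of_nat j)"

definition euclid_poly :: "nat \<Rightarrow> rpoly" where
  "euclid_poly n = (\<Sum>i<n. \<Sum>j<n.
     ((of_nat i - of_nat j) * lagrange n (X 0 1) i * lagrange n (X 1 1) j)\<^sup>2)"

lemma indet_in_block: "m \<ge> 1 \<Longrightarrow> indet (X i 1) \<in> poly_ring (block m i)"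
  by (rule indet_in_poly_ring) (auto simp: block_def)

lemma lagrange_in_block: "m \<ge> 1 \<Longrightarrow> lagrange n (X i 1) j \<in> poly_ring (block m i)"
  unfolding lagrange_def by (intro poly_ring_closed indet_in_block)

text \<open>The Lagrange products are not normalized: at their own node they are merely nonzero,
  which suffices for the sign pattern.\<close>

lemma ev_lagrange:
  assumes "i < n" "k < n"
  shows "ev (lagrange n (X 0 1) i) (real k) b = 0 \<longleftrightarrow> i \<noteq> k"
    "ev (lagrange n (X 1 1) i) a (real k) = 0 \<longleftrightarrow> i \<noteq> k"
  using assms by (auto simp: lagrange_def simp del: One_nat_def)

lemma off_diagonal_mono: "off_diagonal p n x \<Longrightarrow> k \<le> n \<Longrightarrow> off_diagonal p k x"
  by (auto simp: off_diagonal_def)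

lemma off_diagonal_euclid_poly: "off_diagonal (euclid_poly n) n real"
proof -
  have "ev (euclid_poly n) (real k) (real l)
     = (real k - real l)\<^sup>2 * (ev (lagrange n (X 0 1) k) (real k) (real l))\<^sup>2
       * (ev (lagrange n (X 1 1) l) (real k) (real l))\<^sup>2"
    (is "_ = ?t k l") if "k < n" "l < n" for k l
  proof -
    have "ev (euclid_poly n) (real k) (real l) = (\<Sum>i<n. \<Sum>j<n. if j = l then (if i = k then ?t k l else 0) else 0)"
      unfolding euclid_poly_def ev_sum
      using that by (intro sum.cong refl) (auto simp: ev_lagrange power_mult_distrib simp del: One_nat_def)
    also have "\<dots> = ?t k l" using that by simp
    finally show ?thesis .
  qed
  then show ?thesis
    by (auto simp: off_diagonal_def ev_lagrange simp del: One_nat_def)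
qed

text \<open>Expanding \<open>(i - j)^2 = i^2 - 2 i j + j^2\<close> separates the double sum into
  three products of the moment sums \<open>s0 k\<close> and \<open>s1 k\<close>.\<close>

lemma edge_rank_euclid_poly:
  assumes "m \<ge> 1" "n \<ge> 3"
  shows "edge_rank m (euclid_poly n) = 3"
proof (rule antisym)
  define L0 L1 where "L0 = lagrange n (X 0 1)" and "L1 = lagrange n (X 1 1)"
  define s0 s1 where "s0 = (\<lambda>k. \<Sum>i<n. of_nat i ^ k * (L0 i)\<^sup>2)" and "s1 = (\<lambda>k. \<Sum>i<n. of_nat i ^ k * (L1 i)\<^sup>2)"
  have "euclid_poly n = (\<Sum>i<n. \<Sum>j<n.
      (of_nat i ^ 2 * (L0 i)\<^sup>2) * (of_nat j ^ 0 * (L1 j)\<^sup>2)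
    + (- 2 * (of_nat i ^ 1 * (L0 i)\<^sup>2)) * (of_nat j ^ 1 * (L1 j)\<^sup>2)
    + (of_nat i ^ 0 * (L0 i)\<^sup>2) * (of_nat j ^ 2 * (L1 j)\<^sup>2))"
    unfolding euclid_poly_def L0_def L1_def by (intro sum.cong refl) (simp add: power2_eq_square algebra_simps)
  also have "\<dots> = s0 2 * s1 0 + (- 2 * s0 1) * s1 1 + s0 0 * s1 2"
    by (simp only: s0_def s1_def sum.distrib sum_product[of _ "{..<n}" _ "{..<n}"] sum_distrib_left[of "- 2"])
  finally have p: "euclid_poly n = s0 2 * s1 0 + (- 2 * s0 1) * s1 1 + s0 0 * s1 2" .
  have s: "s0 k \<in> poly_ring (block m 0)" "s1 k \<in> poly_ring (block m 1)" for k
    unfolding s0_def s1_def L0_def L1_def by (intro poly_ring_closed lagrange_in_block assms(1))+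
  have "- 2 \<in> poly_ring V" for V
    using of_nat_in_poly_ring[of 2] by (auto intro: uminus_in_poly_ring)
  then show "edge_rank m (euclid_poly n) \<le> 3"
    using s by (intro edge_rank_le_3[OF _ _ _ _ _ _ p] mult_in_poly_ring)
  show "3 \<le> edge_rank m (euclid_poly n)"
    using edge_rank_ge off_diagonal_mono off_diagonal_euclid_poly assms(2) by blast
qed

lemma edge_sos_rank_euclid_poly:
  assumes "m \<ge> 1" "n \<ge> 2"
  shows "edge_sos_rank m (euclid_poly n) = 2"
proof (rule antisym)
  define L0 L1 where "L0 = lagrange n (X 0 1)" and "L1 = lagrange n (X 1 1)"
  \<comment> \<open>The difference \<open>i - j\<close> is the inner product of
    \<open>(i, -1)\<close> and \<open>(1, j)\<close>, so two summands serve every square.\<close>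
  define q0 where "q0 = (\<lambda>i \<alpha>::nat. if \<alpha> = 1 then of_nat i * L0 i else - L0 i)"
  define q1 where "q1 = (\<lambda>j \<alpha>::nat. if \<alpha> = 1 then L1 j else of_nat j * L1 j)"
  have p: "euclid_poly n = (\<Sum>k0<n. \<Sum>k1<n. (\<Sum>\<alpha>=1..2::nat. q0 k0 \<alpha> * q1 k1 \<alpha>)\<^sup>2)"
    unfolding euclid_poly_def
    by (intro sum.cong refl) (simp add: eval_nat_numeral q0_def q1_def L0_def L1_def algebra_simps)
  have "q0 k \<alpha> \<in> poly_ring (block m 0)" "q1 k \<alpha> \<in> poly_ring (block m 1)" for k \<alpha>
    unfolding q0_def q1_def L0_def L1_def
    by (auto intro!: poly_ring_closed lagrange_in_block assms(1) simp del: One_nat_def)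
  then show "edge_sos_rank m (euclid_poly n) \<le> 2"
    unfolding edge_sos_rank_def numeral_eq_enat using p
    by (intro Inf_lower CollectI exI[of _ 2] conjI refl exI[of _ "{..<n}"] exI[of _ q0] exI[of _ q1]) auto
  show "2 \<le> edge_sos_rank m (euclid_poly n)"
    using edge_sos_rank_ge off_diagonal_mono off_diagonal_euclid_poly assms(2) by blast
qed

lemma square_in_sums_of_squares: "p \<in> poly_ring V \<Longrightarrow> p\<^sup>2 \<in> sums_of_squares V"
  unfolding sums_of_squares_def
  by (intro CollectI exI[of _ 1] exI[of _ "\<lambda>_. p"]) simp

lemma edge_sep_rank_euclid_poly_finite:
  assumes "m \<ge> 1"
  shows "edge_sep_rank m (euclid_poly n) < \<infinity>"
proof -
  define L0 L1 where "L0 = lagrange n (X 0 1)" and "L1 = lagrange n (X 1 1)"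
  \<comment> \<open>The pair \<open>(i, j)\<close> is stored as
    \<open>\<alpha> - 1 = j + i * n\<close>, shifted because summands are counted from 1. The scalar
    \<open>(i - j)^2\<close> is put at vertex 1.\<close>
  define f0 where "f0 = (\<lambda>\<alpha>. (L0 ((\<alpha> - 1) div n))\<^sup>2)"
  define f1 where "f1 = (\<lambda>\<alpha>. ((of_nat ((\<alpha> - 1) div n) - of_nat ((\<alpha> - 1) mod n)) * L1 ((\<alpha> - 1) mod n))\<^sup>2)"
  have "euclid_poly n = (\<Sum>i<n. \<Sum>j<n. f0 (Suc (j + i * n)) * f1 (Suc (j + i * n)))"
    unfolding euclid_poly_def
    by (intro sum.cong refl) (simp add: f0_def f1_def L0_def L1_def power_mult_distrib mult_ac)
  also have "\<dots> = (\<Sum>\<alpha><n * n. f0 (Suc \<alpha>) * f1 (Suc \<alpha>))"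
    using sum.nat_group[of "\<lambda>\<alpha>. f0 (Suc \<alpha>) * f1 (Suc \<alpha>)" n n]
    by (simp add: lessThan_atLeast0 sum.shift_bounds_nat_ivl[of _ 0 _ n, simplified] add.commute)
  also have "\<dots> = (\<Sum>\<alpha>=1..n * n. f0 \<alpha> * f1 \<alpha>)"
    by (rule sum.reindex_bij_witness[of _ "\<lambda>\<alpha>. \<alpha> - 1" Suc]) auto
  finally have p: "euclid_poly n = (\<Sum>\<alpha>=1..n * n. f0 \<alpha> * f1 \<alpha>)" .
  have "f0 \<alpha> \<in> sums_of_squares (block m 0)" "f1 \<alpha> \<in> sums_of_squares (block m 1)" for \<alpha>
    unfolding f0_def f1_def L0_def L1_def
    by (intro square_in_sums_of_squares poly_ring_closed lagrange_in_block assms(1))+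
  with p have "edge_sep_rank m (euclid_poly n) \<le> enat (n * n)"
    unfolding edge_sep_rank_def
    by (intro Inf_lower CollectI exI[of _ "n * n"] exI[of _ f0] exI[of _ f1] conjI refl) auto
  then show ?thesis by (rule order_le_less_trans) simp
qed

lemma euclid_poly_in_poly_ring:
  assumes "m \<ge> 1"
  shows "euclid_poly n \<in> poly_ring (block m 0 \<union> block m 1)"
proof -
  have "lagrange n (X 0 1) j \<in> poly_ring (block m 0 \<union> block m 1)"
     "lagrange n (X 1 1) j \<in> poly_ring (block m 0 \<union> block m 1)" for j
    using lagrange_in_block[OF assms] by (blast intro: poly_ring_mono[rotated])+
  then show ?thesis unfolding euclid_poly_def by (intro poly_ring_closed)
qed


section \<open>Linear dependence and biorthogonal families\<close>

lemma nontrivial_dependency: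
  fixes U :: "'b \<Rightarrow> 'a \<Rightarrow> real"
  assumes "finite A" "finite J" "card A < card J"
  shows "\<exists>c. (\<exists>i\<in>J. c i \<noteq> 0) \<and> (\<forall>\<alpha>\<in>A. (\<Sum>i\<in>J. c i * U i \<alpha>) = 0)"
  using assms
proof (induction A arbitrary: J U rule: finite_induct)
  case empty
  then obtain i where "i \<in> J" by fastforce
  then show ?case by (intro exI[of _ "\<lambda>_. 1"]) auto
next
  case (insert \<beta> A)
  show ?case
  proof (cases "\<forall>i\<in>J. U i \<beta> = 0")
    case True
    have "card A < card J" using insert by simp
    from insert.IH[OF insert.prems(1) this, of U] obtain c
      where "\<exists>i\<in>J. c i \<noteq> 0" "\<forall>\<alpha>\<in>A. (\<Sum>i\<in>J. c i * U i \<alpha>) = 0" by blast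
    with True show ?thesis by (intro exI[of _ c]) simp
  next
    case False
    \<comment> \<open>Gaussian elimination: \<open>U k\<close> is the pivot, and subtracting its
      multiples clears the coordinate \<open>\<beta>\<close> of the other vectors.\<close>
    then obtain k where k: "k \<in> J" "U k \<beta> \<noteq> 0" by auto
    define U' where "U' = (\<lambda>i \<alpha>. U i \<alpha> - U i \<beta> / U k \<beta> * U k \<alpha>)"
    have "card A < card (J - {k})" using insert k by simp
    with insert.IH[of "J - {k}" U'] insert.prems(1)
    obtain c where c: "\<exists>i\<in>J - {k}. c i \<noteq> 0" "\<And>\<alpha>. \<alpha> \<in> A \<Longrightarrow> (\<Sum>i\<in>J - {k}. c i * U' i \<alpha>) = 0"
      by auto
    \<comment> \<open>The pivot coefficient makes the combination of the \<open>U i\<close> by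
      \<open>d\<close> equal to that of the \<open>U' i\<close> by \<open>c\<close>.\<close>
    define d where "d = c(k := - (\<Sum>i\<in>J - {k}. c i * U i \<beta>) / U k \<beta>)"
    have "(\<Sum>i\<in>J. d i * U i \<alpha>) = (\<Sum>i\<in>J - {k}. c i * U' i \<alpha>)" for \<alpha>
    proof -
      have "(\<Sum>i\<in>J. d i * U i \<alpha>) = d k * U k \<alpha> + (\<Sum>i\<in>J - {k}. d i * U i \<alpha>)"
        using insert.prems(1) k(1) by (simp add: sum.remove)
      also have "(\<Sum>i\<in>J - {k}. d i * U i \<alpha>) = (\<Sum>i\<in>J - {k}. c i * U i \<alpha>)"
        by (intro sum.cong) (auto simp: d_def)
      also have "d k * U k \<alpha> = - (\<Sum>i\<in>J - {k}. c i * (U i \<beta> / U k \<beta> * U k \<alpha>))"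
        by (simp add: d_def sum_distrib_left sum_divide_distrib mult_ac)
      finally show ?thesis
        by (simp add: U'_def right_diff_distrib sum_subtractf)
    qed
    moreover have "U' i \<beta> = 0" for i using k(2) by (simp add: U'_def)
    ultimately have "\<forall>\<alpha>\<in>insert \<beta> A. (\<Sum>i\<in>J. d i * U i \<alpha>) = 0"
      using c(2) by auto
    moreover have "\<exists>i\<in>J. d i \<noteq> 0" using c(1) by (auto simp: d_def)
    ultimately show ?thesis by blast
  qed
qed

text \<open>Pairing a dependency among the \<open>U i\<close> with \<open>V j\<close> leaves only
  the nonzero diagonal term times \<open>c j\<close>. So the \<open>U i\<close> are independent in a
  space of dimension \<open>card A\<close>.\<close>

lemma card_biorthogonal_le:
  fixes U V :: "'b \<Rightarrow> 'a \<Rightarrow> real"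
  assumes "finite A" "finite J"
    and orth: "\<And>i j. i \<in> J \<Longrightarrow> j \<in> J \<Longrightarrow> i \<noteq> j \<Longrightarrow> (\<Sum>\<alpha>\<in>A. U i \<alpha> * V j \<alpha>) = 0"
    and diag: "\<And>i. i \<in> J \<Longrightarrow> (\<Sum>\<alpha>\<in>A. U i \<alpha> * V i \<alpha>) \<noteq> 0"
  shows "card J \<le> card A"
proof (rule ccontr)
  assume "\<not> card J \<le> card A"
  then obtain c j where c: "j \<in> J" "c j \<noteq> 0" "\<And>\<alpha>. \<alpha> \<in> A \<Longrightarrow> (\<Sum>i\<in>J. c i * U i \<alpha>) = 0"
    using nontrivial_dependency[of A J U] assms(1,2) by auto
  have "0 = (\<Sum>\<alpha>\<in>A. (\<Sum>i\<in>J. c i * U i \<alpha>) * V j \<alpha>)"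
    using c(3) by simp
  also have "\<dots> = (\<Sum>i\<in>J. c i * (\<Sum>\<alpha>\<in>A. U i \<alpha> * V j \<alpha>))"
    by (simp add: sum_distrib_left sum_distrib_right mult.assoc) (rule sum.swap)
  also have "\<dots> = (\<Sum>i\<in>J. if i = j then c j * (\<Sum>\<alpha>\<in>A. U j \<alpha> * V j \<alpha>) else 0)"
    using c(1) orth by (intro sum.cong) auto
  also have "\<dots> = c j * (\<Sum>\<alpha>\<in>A. U j \<alpha> * V j \<alpha>)"
    using c(1) assms(2) by simp
  finally show False using c diag by auto
qed

section \<open>Coefficients of sums of squares\<close>

definition bicoeff :: "real poly poly \<Rightarrow> nat \<Rightarrow> nat \<Rightarrow> real" where
  "bicoeff H i j = coeff (coeff H j) i"

lemma bicoeff_sum: "bicoeff (sum f A) i j = (\<Sum>t\<in>A. bicoeff (f t) i j)"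
  by (simp add: bicoeff_def coeff_sum)

lemma bicoeff_square:
  "bicoeff (H\<^sup>2) a b = (\<Sum>j\<le>b. \<Sum>i\<le>a. bicoeff H i j * bicoeff H (a - i) (b - j))"
  by (simp add: bicoeff_def power2_eq_square coeff_mult coeff_sum)

lemma finite_bicoeff_support: "finite {(i, j). bicoeff H i j \<noteq> 0}"
proof (rule finite_subset)
  show "{(i, j). bicoeff H i j \<noteq> 0} \<subseteq> (\<Union>j\<le>degree H. {..degree (coeff H j)} \<times> {j})"
    by (fastforce simp: bicoeff_def intro: le_degree)
qed auto

text \<open>The hypothesis excludes \<open>(a, b)\<close> as midpoint of two other support points,
  as at a vertex of the Newton polytope. No cross terms reach \<open>(2 * a, 2 * b)\<close>, so the
  squares cannot cancel there.\<close>

lemma bicoeff_sum_squares_vertex: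
  assumes vertex: "\<And>t i j i' j'. t \<in> T \<Longrightarrow> bicoeff (H t) i j \<noteq> 0 \<Longrightarrow> bicoeff (H t) i' j' \<noteq> 0 \<Longrightarrow>
        i + i' = 2 * a \<Longrightarrow> j + j' = 2 * b \<Longrightarrow> i = a \<and> j = b"
  shows "bicoeff (\<Sum>t\<in>T. (H t)\<^sup>2) (2 * a) (2 * b) = (\<Sum>t\<in>T. (bicoeff (H t) a b)\<^sup>2)"
  unfolding bicoeff_sum
proof (intro sum.cong refl)
  fix t assume t: "t \<in> T"
  have "bicoeff ((H t)\<^sup>2) (2 * a) (2 * b)
      = (\<Sum>j\<le>2 * b. \<Sum>i\<le>2 * a. bicoeff (H t) i j * bicoeff (H t) (2 * a - i) (2 * b - j))"
    by (rule bicoeff_square)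
  also have "\<dots> = (\<Sum>j\<le>2 * b. if j = b then \<Sum>i\<le>2 * a. if i = a then (bicoeff (H t) a b)\<^sup>2 else 0 else 0)"
  proof (intro sum.cong refl, goal_cases)
    case (1 j)
    have "bicoeff (H t) i j * bicoeff (H t) (2 * a - i) (2 * b - j)
        = (if j = b then if i = a then (bicoeff (H t) a b)\<^sup>2 else 0 else 0)" if "i \<le> 2 * a" for i
    proof (cases "i = a \<and> j = b")
      case True
      then show ?thesis by (simp add: power2_eq_square mult_2)
    next
      case False
      then have "bicoeff (H t) i j = 0 \<or> bicoeff (H t) (2 * a - i) (2 * b - j) = 0"
        using vertex[OF t, of i j "2 * a - i" "2 * b - j"] that 1 by fastforce
      then show ?thesis using False by auto
    qed
    then show ?case by simp
  qed
  also have "\<dots> = (bicoeff (H t) a b)\<^sup>2" by simp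
  finally show "bicoeff ((H t)\<^sup>2) (2 * a) (2 * b) = (bicoeff (H t) a b)\<^sup>2" .
qed

section \<open>The AM-GM form as a sum of squares\<close>

definition agiform :: "nat \<Rightarrow> rpoly" where
  "agiform D = indet (X 0 1) ^ D - const (real D) * indet (X 0 1) * indet (X 1 1) ^ (D - 1)
     + const (real (D - 1)) * indet (X 1 1) ^ D"

text \<open>Subtracting the square leaves \<open>2 x^e y^e - 2e x y^(2e-1) + (2e-2) y^(2e)\<close>,
  which is \<open>2 y^e\<close> times the form of degree \<open>e\<close>.\<close>

lemma agiform_double:
  assumes "e \<ge> 1"
  shows "agiform (2 * e) = (indet (X 0 1) ^ e - indet (X 1 1) ^ e)\<^sup>2 + const 2 * indet (X 1 1) ^ e * agiform e"
proof -
  obtain n where e: "e = Suc n" using assms by (cases e) auto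
  have "const 2 = 2" using const_of_nat[of 2] by simp
  moreover have "indet (X 0 1) ^ (2 * n) = indet (X 0 1) ^ n * indet (X 0 1) ^ n"
    "indet (X 1 1) ^ (2 * n) = indet (X 1 1) ^ n * indet (X 1 1) ^ n"
    by (simp_all only: mult_2 power_add)
  ultimately show ?thesis
    unfolding agiform_def const_of_nat e
    by (simp add: power2_eq_square algebra_simps del: One_nat_def)
qed

text \<open>Unrolls \<open>agiform_double\<close> down to degree one, where the form is zero. All
  weights are positive and all outer powers of \<open>y\<close> even.\<close>

lemma agiform_sum_squares:
  "agiform (2 ^ m) = (\<Sum>k<m. const (2 ^ (m - 1 - k)) * indet (X 1 1) ^ (2 ^ m - 2 ^ (k + 1))
     * (indet (X 0 1) ^ 2 ^ k - indet (X 1 1) ^ 2 ^ k)\<^sup>2)"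
proof (induction m)
  case 0
  then show ?case using const_of_nat[of 0] const_of_nat[of 1] by (simp add: agiform_def)
next
  case (Suc m)
  let ?x = "indet (X 0 1)" and ?y = "indet (X 1 1)"
  have "const 2 * ?y ^ 2 ^ m * (const (2 ^ (m - 1 - k)) * ?y ^ (2 ^ m - 2 ^ (k + 1)) * (?x ^ 2 ^ k - ?y ^ 2 ^ k)\<^sup>2)
     = const (2 ^ (m - k)) * ?y ^ (2 ^ Suc m - 2 ^ (k + 1)) * (?x ^ 2 ^ k - ?y ^ 2 ^ k)\<^sup>2" if "k < m" for k
  proof -
    have "(2::nat) ^ (k + 1) \<le> 2 ^ m" using that by (intro power_increasing) auto
    then have "(2::nat) ^ Suc m - 2 ^ (k + 1) = 2 ^ m + (2 ^ m - 2 ^ (k + 1))" by simp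
    then have "?y ^ (2 ^ Suc m - 2 ^ (k + 1)) = ?y ^ 2 ^ m * ?y ^ (2 ^ m - 2 ^ (k + 1))"
      by (simp only: power_add)
    moreover have "(2::real) ^ (m - k) = 2 * 2 ^ (m - 1 - k)"
      using that by (simp flip: power_Suc add: Suc_diff_Suc)
    ultimately show ?thesis by (simp only: const_mult mult_ac)
  qed
  moreover have "const 1 = 1" using const_of_nat[of 1] by simp
  ultimately show ?case
    using agiform_double[of "2 ^ m"] by (simp add: Suc.IH sum_distrib_left)
qed

section \<open>Exponents occurring in squares that sum to the AM-GM form\<close>

lemma bicoeff_monomial:
  "bicoeff (bipoly (const c * indet (X 0 1) ^ i * indet (X 1 1) ^ j)) a b = (if a = i \<and> b = j then c else 0)"
proof -
  have "[:[:0, 1:]:] ^ i = [:monom (1::real) i:]"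
    by (simp add: poly_const_pow monom_altdef)
  moreover have "[:0, 1:] ^ j = monom (1::real poly) j"
    by (simp add: monom_altdef)
  ultimately show ?thesis
    by (simp add: bicoeff_def bipoly_const var_img_def)
qed

lemma bicoeff_agiform:
  "bicoeff (bipoly (agiform D)) a b = (if a = D \<and> b = 0 then 1 else 0)
     - (if a = 1 \<and> b = D - 1 then real D else 0) + (if a = 0 \<and> b = D then real (D - 1) else 0)"
proof -
  have "agiform D = const 1 * indet (X 0 1) ^ D * indet (X 1 1) ^ 0
    - const (real D) * indet (X 0 1) ^ 1 * indet (X 1 1) ^ (D - 1)
    + const (real (D - 1)) * indet (X 0 1) ^ 0 * indet (X 1 1) ^ D"
    using const_of_nat[of 1] by (simp add: agiform_def)
  moreover have "bicoeff (bipoly (p - q + r)) a b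
      = bicoeff (bipoly p) a b - bicoeff (bipoly q) a b + bicoeff (bipoly r) a b" for p q r
    by (simp add: bicoeff_def)
  ultimately show ?thesis by (simp only: bicoeff_monomial)
qed

text \<open>
  A maximum point of the functional \<open>s * (i + j) + i\<close> over the support, with $|s|$ larger than all
  exponents of $x$, is a vertex of the Newton polytope, so its double must occur in the form.
  Both signs of \<open>s\<close> together pin the total degree.
\<close>

lemma agiform_squares_homogeneous:
  assumes T: "finite T" and sum: "bipoly (agiform (2 * d)) = (\<Sum>t\<in>T. (H t)\<^sup>2)"
    and t: "t \<in> T" "bicoeff (H t) i j \<noteq> 0"
  shows "i + j = d"
proof -
  define Z where "Z = (\<Union>t\<in>T. {(i, j). bicoeff (H t) i j \<noteq> 0})"
  have Z: "finite Z" "(i, j) \<in> Z"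
    using T t finite_bicoeff_support by (auto simp: Z_def)
  define M where "M = int (Suc (Max (fst ` Z)))"
  have M: "int a < M" if "(a, b) \<in> Z" for a b
  proof -
    have "fst (a, b) \<in> fst ` Z" using that by (rule imageI)
    then have "a \<le> Max (fst ` Z)" unfolding fst_conv using Z(1) by (intro Max_ge finite_imageI)
    then show ?thesis by (simp add: M_def)
  qed
  have *: "s * (int i + int j - int d) < M" if s: "\<bar>s\<bar> = M" for s
  proof -
    define f where "f = (\<lambda>(a, b). s * (int a + int b) + int a)"
    have "Max (f ` Z) \<in> f ` Z" using Z by (intro Max_in) auto
    then obtain z where z: "z \<in> Z" "f z = Max (f ` Z)" by auto
    obtain a b where "z = (a, b)" by fastforce
    with z Z(1) have ab: "(a, b) \<in> Z" and max: "\<And>z'. z' \<in> Z \<Longrightarrow> f z' \<le> f (a, b)"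
      by auto
    \<comment> \<open>Equal values make \<open>s\<close> times the difference of total degrees equal
      to a difference of \<open>x\<close> exponents, which is smaller than \<open>M\<close> in
      absolute value; so both differences are zero.\<close>
    have inj: "k = a \<and> l = b" if kl: "(k, l) \<in> Z" "f (k, l) = f (a, b)" for k l
    proof -
      have eq: "s * (int k + int l - (int a + int b)) = int a - int k"
        using kl(2) by (simp add: f_def algebra_simps)
      have "\<bar>int a - int k\<bar> < M" using M[OF kl(1)] M[OF ab] by simp
      then have "M * \<bar>int k + int l - (int a + int b)\<bar> < M * 1"
        unfolding eq[symmetric] abs_mult s by simp
      then have "int k + int l = int a + int b"
        by (subst (asm) mult_less_cancel_left) (auto simp: M_def)
      then show ?thesis using eq by simp
    qed
    \<comment> \<open>Two support points with midpoint \<open>(a, b)\<close> have values averaging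
      to the maximum, so both attain it and \<open>inj\<close> applies.\<close>
    have "bicoeff (bipoly (agiform (2 * d))) (2 * a) (2 * b) = (\<Sum>t\<in>T. (bicoeff (H t) a b)\<^sup>2)"
      unfolding sum
    proof (rule bicoeff_sum_squares_vertex, rule inj)
      fix t i j i' j' assume *: "t \<in> T" "bicoeff (H t) i j \<noteq> 0" "bicoeff (H t) i' j' \<noteq> 0"
        "i + i' = 2 * a" "j + j' = 2 * b"
      then show "(i, j) \<in> Z" by (auto simp: Z_def)
      moreover have "(i', j') \<in> Z" using * by (auto simp: Z_def)
      moreover have "f (i, j) + f (i', j') = s * (int (i + i') + int (j + j')) + int (i + i')"
        by (simp add: f_def algebra_simps)
      then have "f (i, j) + f (i', j') = 2 * f (a, b)"
        unfolding *(4,5) by (simp add: f_def algebra_simps)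
      ultimately show "f (i, j) = f (a, b)"
        using max[of "(i, j)"] max[of "(i', j')"] by linarith
    qed
    also have "\<dots> > 0"
    proof -
      obtain t where "t \<in> T" "bicoeff (H t) a b \<noteq> 0" using ab by (auto simp: Z_def)
      then show ?thesis using T by (intro sum_pos2[of _ t]) auto
    qed
    \<comment> \<open>Among monomials with both exponents even, at most \<open>x^(2d)\<close> and
      \<open>y^(2d)\<close> have a nonzero coefficient.\<close>
    finally have "a + b = d"
      by (auto simp: bicoeff_agiform split: if_splits)
    \<comment> \<open>Maximality compared with \<open>(i, j)\<close> reads
      \<open>s * (i + j - d) \<le> a - i\<close>, and \<open>a < M\<close>.\<close>
    then show ?thesis
      using max[OF Z(2)] M[OF ab] by (auto simp: f_def algebra_simps)
  qed
  \<comment> \<open>The two signs of \<open>s\<close> confine the integer \<open>i + j - d\<close>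
    strictly between -1 and 1.\<close>
  have "M * (int i + int j - int d) < M * 1" "M * (int d - (int i + int j)) < M * 1"
    using *[of M] *[of "- M"] by (auto simp: M_def algebra_simps)
  then show ?thesis
    by (subst (asm) (1 2) mult_less_cancel_left) (auto simp: M_def)
qed

text \<open>Without such a \<open>k\<close>, exponents adding up to \<open>2 * i\<close> are both
  \<open>i\<close>, and homogeneity fixes the powers of \<open>y\<close>. Then \<open>x^(2i)\<close>
  gets a positive coefficient, which the form lacks for \<open>0 < i < d\<close>.\<close>

lemma agiform_squares_next_exponent:
  assumes T: "finite T" and sum: "bipoly (agiform (2 * d)) = (\<Sum>t\<in>T. (H t)\<^sup>2)"
    and t: "t \<in> T" "bicoeff (H t) i j \<noteq> 0" and i: "0 < i" "i < d"
  shows "\<exists>t\<in>T. \<exists>k l. bicoeff (H t) k l \<noteq> 0 \<and> i < k \<and> k \<le> 2 * i"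
proof (rule ccontr)
  assume none: "\<not> ?thesis"
  note hom = agiform_squares_homogeneous[OF T sum]
  have "bicoeff (bipoly (agiform (2 * d))) (2 * i) (2 * j) = (\<Sum>t\<in>T. (bicoeff (H t) i j)\<^sup>2)"
    unfolding sum
  proof (rule bicoeff_sum_squares_vertex)
    fix t k l k' l' assume *: "t \<in> T" "bicoeff (H t) k l \<noteq> 0" "bicoeff (H t) k' l' \<noteq> 0"
      "k + k' = 2 * i" "l + l' = 2 * j"
    then have "k \<le> 2 * i" "k' \<le> 2 * i" by auto
    then have "\<not> i < k" "\<not> i < k'" using none * by blast+
    then have "k = i" using *(4) by simp
    moreover have "k + l = i + j" using hom[OF *(1,2)] hom[OF t] by simp
    ultimately show "k = i \<and> l = j" by simp
  qed
  also have "\<dots> > 0" using T t by (intro sum_pos2[of _ t]) auto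
  finally show False using i hom[OF t] by (auto simp: bicoeff_agiform split: if_splits)
qed

text \<open>The mixed term of the form is linear in \<open>x\<close>, and in a square such a term
  needs a coefficient at \<open>x^1\<close>.\<close>

lemma agiform_squares_exponent_one:
  assumes T: "finite T" and sum: "bipoly (agiform (2 * d)) = (\<Sum>t\<in>T. (H t)\<^sup>2)" and d: "d \<ge> 1"
  shows "\<exists>t\<in>T. \<exists>l. bicoeff (H t) 1 l \<noteq> 0"
proof (rule ccontr)
  assume "\<not> ?thesis"
  then have "bicoeff ((H t)\<^sup>2) 1 (2 * d - 1) = 0" if "t \<in> T" for t
    using that by (auto simp: bicoeff_square intro!: sum.neutral)
  then have "bicoeff (bipoly (agiform (2 * d))) 1 (2 * d - 1) = 0"
    unfolding sum bicoeff_sum by simp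
  then show False using d by (auto simp: bicoeff_agiform split: if_splits)
qed

text \<open>Steps that at most double cannot jump over a dyadic interval, so \<open>J\<close> meets
  each of the disjoint intervals \<open>(2^(k-1), 2^k]\<close> with \<open>k < n\<close>.\<close>

lemma card_doubling_set:
  fixes J :: "nat set"
  assumes J: "finite J" "1 \<in> J" and step: "\<And>i. i \<in> J \<Longrightarrow> 0 < i \<Longrightarrow> i < 2 ^ n \<Longrightarrow> \<exists>k\<in>J. i < k \<and> k \<le> 2 * i"
  shows "n \<le> card J"
proof -
  have "\<exists>g\<in>J. g \<le> 2 ^ k \<and> 2 ^ k < 2 * g" if "k < n" for k
  proof -
    define S where "S = {i\<in>J. 0 < i \<and> i \<le> 2 ^ k}"
    have S: "finite S" "S \<noteq> {}" using J by (auto simp: S_def)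
    \<comment> \<open>The element after the largest one up to \<open>2 ^ k\<close> exceeds
      \<open>2 ^ k\<close> but is at most \<open>2 * g\<close>.\<close>
    define g where "g = Max S"
    have g: "g \<in> J" "0 < g" "g \<le> 2 ^ k" using Max_in[OF S] by (auto simp: g_def S_def)
    have "(2::nat) ^ k < 2 ^ n" using that by simp
    then obtain k' where k': "k' \<in> J" "g < k'" "k' \<le> 2 * g" using step[of g] g by fastforce
    have "k' \<notin> S" using k'(2) Max_ge[OF S(1), of k'] by (auto simp: g_def)
    then have "2 ^ k < k'" using k' by (auto simp: S_def)
    then show ?thesis using g k' by auto
  qed
  then obtain g where g: "\<And>k. k < n \<Longrightarrow> g k \<in> J \<and> g k \<le> 2 ^ k \<and> 2 ^ k < 2 * g k"
    by metis
  have less: "g k < g l" if "k < l" "l < n" for k l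
  proof -
    have "2 * g k \<le> 2 ^ Suc k" using g[of k] that by auto
    also have "(2::nat) ^ Suc k \<le> 2 ^ l" using that by (intro power_increasing) auto
    also have "\<dots> < 2 * g l" using g[of l] that by auto
    finally show ?thesis by simp
  qed
  have "inj_on g {..<n}"
    by (rule inj_onI) (metis less lessThan_iff less_irrefl linorder_neqE_nat)
  then show ?thesis
    using card_inj_on_le[of g "{..<n}" J] g J(1) by auto
qed

section \<open>Rank bounds for the AM-GM form\<close>

lemma edge_sos_rank_agiform_ge: "enat n \<le> edge_sos_rank m (agiform (2 ^ Suc n))"
  unfolding edge_sos_rank_def
proof (rule Inf_greatest, elim CollectE exE conjE)
  fix z r S0 S1 q0 q1
  assume z: "z = enat r" and fin: "finite S0" "finite S1"
    and q0: "\<forall>k\<in>S0. \<forall>\<alpha>\<in>{1..r}. q0 k \<alpha> \<in> poly_ring (block m 0)"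
    and q1: "\<forall>k\<in>S1. \<forall>\<alpha>\<in>{1..r}. q1 k \<alpha> \<in> poly_ring (block m 1)"
    and p: "agiform (2 ^ Suc n) = (\<Sum>k0\<in>S0. \<Sum>k1\<in>S1. (\<Sum>\<alpha>=1..r. q0 k0 \<alpha> * q1 k1 \<alpha>)\<^sup>2)"
  define T where "T = S0 \<times> S1"
  define H where "H = (\<lambda>(k, l). bipoly (\<Sum>\<alpha>=1..r. q0 k \<alpha> * q1 l \<alpha>))"
  have T: "finite T" using fin by (simp add: T_def)
  have sum: "bipoly (agiform (2 * 2 ^ n)) = (\<Sum>t\<in>T. (H t)\<^sup>2)"
    using p by (simp add: T_def H_def sum.cartesian_product case_prod_unfold)
  note hom = agiform_squares_homogeneous[OF T sum]
  define U where "U = (\<lambda>k i \<alpha>. bicoeff (bipoly (q0 k \<alpha>)) i 0)"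
  define V where "V = (\<lambda>l j \<alpha>. bicoeff (bipoly (q1 l \<alpha>)) 0 j)"
  have H: "bicoeff (H (k, l)) i j = (\<Sum>\<alpha>=1..r. U k i \<alpha> * V l j \<alpha>)" if "k \<in> S0" "l \<in> S1" for k l i j
  proof -
    have "bicoeff (H (k, l)) i j = (\<Sum>\<alpha>=1..r. bicoeff (bipoly (q0 k \<alpha> * q1 l \<alpha>)) i j)"
      by (simp add: H_def bicoeff_sum del: bipoly_mult)
    also have "\<dots> = (\<Sum>\<alpha>=1..r. U k i \<alpha> * V l j \<alpha>)"
      unfolding bicoeff_def U_def V_def using that q0 q1
      by (intro sum.cong refl coeff_bipoly_mult[of _ m]) auto
    finally show ?thesis .
  qed
  \<comment> \<open>The union over all squares is taken because the next exponent may occur in a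
    different square.\<close>
  define J where "J = {i. \<exists>t\<in>T. \<exists>j. bicoeff (H t) i j \<noteq> 0}"
  have "J \<subseteq> {..2 ^ n}" using hom by (fastforce simp: J_def)
  then have J: "finite J" by (rule finite_subset) simp
  have "n \<le> card J"
  proof (rule card_doubling_set[OF J])
    show "1 \<in> J"
      using agiform_squares_exponent_one[OF T sum] by (auto simp: J_def)
    show "\<exists>k\<in>J. i < k \<and> k \<le> 2 * i" if "i \<in> J" "0 < i" "i < 2 ^ n" for i
      using agiform_squares_next_exponent[OF T sum _ _ that(2,3)] that(1) by (fastforce simp: J_def)
  qed
  also have "card J \<le> card {1..r}"
  proof -
    have "\<exists>k\<in>S0. \<exists>l\<in>S1. bicoeff (H (k, l)) i (2 ^ n - i) \<noteq> 0" if i: "i \<in> J" for i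
    proof -
      obtain t j where t: "t \<in> T" "bicoeff (H t) i j \<noteq> 0" using i by (auto simp: J_def)
      moreover have "j = 2 ^ n - i" using hom[OF t] by simp
      ultimately show ?thesis by (auto simp: T_def)
    qed
    then obtain K L where KL: "\<And>i. i \<in> J \<Longrightarrow> K i \<in> S0 \<and> L i \<in> S1 \<and> bicoeff (H (K i, L i)) i (2 ^ n - i) \<noteq> 0"
      by metis
    show ?thesis
    proof (rule card_biorthogonal_le[of _ _ "\<lambda>i. U (K i) i" "\<lambda>j. V (L j) (2 ^ n - j)"])
      show "(\<Sum>\<alpha>=1..r. U (K i) i \<alpha> * V (L i) (2 ^ n - i) \<alpha>) \<noteq> 0" if "i \<in> J" for i
        using KL[OF that] H by auto
      show "(\<Sum>\<alpha>=1..r. U (K i) i \<alpha> * V (L j) (2 ^ n - j) \<alpha>) = 0" if "i \<in> J" "j \<in> J" "i \<noteq> j" for i j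
      proof -
        \<comment> \<open>The squares are indexed by a full product, so \<open>(K i, L j)\<close>
          belongs to one of them too, and homogeneity kills its coefficients outside total degree
          \<open>2 ^ n\<close>.\<close>
        have "i + (2 ^ n - j) \<noteq> 2 ^ n" using that \<open>J \<subseteq> {..2 ^ n}\<close> by auto
        then have "bicoeff (H (K i, L j)) i (2 ^ n - j) = 0"
          using hom[of "(K i, L j)"] KL that by (auto simp: T_def)
        then show ?thesis using H KL that by auto
      qed
    qed (use J in auto)
  qed
  finally show "enat n \<le> z" by (simp add: z)
qed

lemma edge_sos_rank_agiform_finite:
  assumes "m \<ge> 1"
  shows "edge_sos_rank m (agiform (2 ^ n)) < \<infinity>"
proof -
  let ?x = "indet (X 0 1)" and ?y = "indet (X 1 1)"
  \<comment> \<open>A square root of the weight of the \<open>k\<close>-th square in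
    \<open>agiform_sum_squares\<close>, with the power of \<open>y\<close> halved.\<close>
  define g where "g = (\<lambda>k. const (sqrt (2 ^ (n - 1 - k))) * ?y ^ (2 ^ (n - 1) - 2 ^ k))"
  \<comment> \<open>One index at vertex 0 suffices: \<open>\<alpha> = 1\<close> carries 1 and
    \<open>\<alpha> = k + 2\<close> carries \<open>x^(2^k)\<close>. Vertex 1 selects the two entries
    needed for its \<open>k\<close>.\<close>
  define q0 where "q0 = (\<lambda>(_::nat) \<alpha>. if \<alpha> = 1 then 1 else ?x ^ 2 ^ (\<alpha> - 2))"
  define q1 where "q1 = (\<lambda>k \<alpha>. if \<alpha> = 1 then - (g k * ?y ^ 2 ^ k) else if \<alpha> = k + 2 then g k else 0)"
  have "const (2 ^ (n - 1 - k)) * ?y ^ (2 ^ n - 2 ^ (k + 1)) * (?x ^ 2 ^ k - ?y ^ 2 ^ k)\<^sup>2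
      = (\<Sum>\<alpha>=1..n + 1. q0 0 \<alpha> * q1 k \<alpha>)\<^sup>2" if "k < n" for k
  proof -
    have "(\<Sum>\<alpha>=1..n + 1. q0 0 \<alpha> * q1 k \<alpha>) = (\<Sum>\<alpha>\<in>{1, k + 2}. q0 0 \<alpha> * q1 k \<alpha>)"
      using that by (intro sum.mono_neutral_right) (auto simp: q1_def)
    also have "\<dots> = g k * (?x ^ 2 ^ k - ?y ^ 2 ^ k)"
      by (simp add: q0_def q1_def algebra_simps)
    finally have "(\<Sum>\<alpha>=1..n + 1. q0 0 \<alpha> * q1 k \<alpha>)\<^sup>2 = (g k)\<^sup>2 * (?x ^ 2 ^ k - ?y ^ 2 ^ k)\<^sup>2"
      by (simp add: power_mult_distrib)
    moreover have "(g k)\<^sup>2 = const (2 ^ (n - 1 - k)) * ?y ^ (2 ^ n - 2 ^ (k + 1))"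
    proof -
      have "(2 ^ (n - 1) - 2 ^ k) * 2 = (2 ^ n - 2 ^ (k + 1) :: nat)"
        using that by (cases n) (simp_all add: diff_mult_distrib mult.commute)
      then show ?thesis
        by (simp add: g_def power_mult_distrib power2_eq_square[of "const _"] flip: const_mult power_mult)
    qed
    ultimately show ?thesis by simp
  qed
  then have "agiform (2 ^ n) = (\<Sum>k0\<in>{0}. \<Sum>k1\<in>{..<n}. (\<Sum>\<alpha>=1..n + 1. q0 k0 \<alpha> * q1 k1 \<alpha>)\<^sup>2)"
    by (simp add: agiform_sum_squares del: One_nat_def)
  moreover have "?x \<in> poly_ring (block m 0)" "?y \<in> poly_ring (block m 1)"
    using indet_in_block[OF assms] by blast+
  then have "q0 k \<alpha> \<in> poly_ring (block m 0)" "q1 k \<alpha> \<in> poly_ring (block m 1)" for k \<alpha>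
    by (simp_all add: q0_def q1_def g_def poly_ring_closed del: One_nat_def)
  ultimately have "edge_sos_rank m (agiform (2 ^ n)) \<le> enat (n + 1)"
    unfolding edge_sos_rank_def
    by (intro Inf_lower CollectI exI[of _ "n + 1"] exI[of _ "{0}"] exI[of _ "{..<n}"]
        exI[of _ q0] exI[of _ q1] conjI refl) auto
  then show ?thesis by (rule order_le_less_trans) simp
qed

text \<open>The nodes are -1, 0, 1. The diagonal vanishes because the coefficients \<open>1\<close>,
  \<open>- D\<close> and \<open>D - 1\<close> add up to zero; for even \<open>D\<close> the mixed
  term is positive at opposite signs.\<close>

lemma off_diagonal_agiform:
  assumes "even D" "D \<ge> 2"
  shows "off_diagonal (agiform D) 3 (\<lambda>i. real i - 1)"
proof -
  have c: "ev (const k) a b = k" for k a b by (simp add: ev_def bipoly_const)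
  have "odd (D - 1)" using assms by simp
  have "(- 1) ^ D = (1::real)" "(- 1) ^ (D - 1) = (- 1::real)"
    using assms \<open>odd (D - 1)\<close> by (simp_all del: even_diff_nat)
  then have "ev (agiform D) (real i - 1) (real j - 1)
      = (if i = j then 0 else if i = 1 then real (D - 1) else if j = 1 then 1 else 2 * real D)"
    if "i < 3" "j < 3" for i j
    using that assms(2) by (auto simp: numeral_3_eq_3 less_Suc_eq agiform_def c of_nat_diff power_0_left
        simp del: ev_simps(9,10) simp add: ev_simps(9,10)[simplified])
  then show ?thesis using assms(2) by (simp add: off_diagonal_def)
qed

lemma edge_rank_agiform:
  assumes "m \<ge> 1" "even D" "D \<ge> 2"
  shows "edge_rank m (agiform D) = 3"
proof (rule antisym)
  let ?x = "indet (X 0 1)" and ?y = "indet (X 1 1)"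
  have "?x \<in> poly_ring (block m 0)" "?y \<in> poly_ring (block m 1)"
    using indet_in_block[OF assms(1)] by blast+
  then show "edge_rank m (agiform D) \<le> 3"
    by (intro edge_rank_le_3[of "?x ^ D" _ "- (const (real D) * ?x)" 1 1 "?y ^ (D - 1)" "const (real (D - 1)) * ?y ^ D"])
       (simp_all add: poly_ring_closed agiform_def del: One_nat_def)
  show "3 \<le> edge_rank m (agiform D)"
    using edge_rank_ge off_diagonal_agiform assms by blast
qed

lemma agiform_in_poly_ring:
  assumes "m \<ge> 1"
  shows "agiform D \<in> poly_ring (block m 0 \<union> block m 1)"
proof -
  have "indet (X i 1) \<in> poly_ring (block m 0 \<union> block m 1)" if "i \<in> {0, 1}" for i
    using that assms by (intro indet_in_poly_ring) (auto simp: block_def)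
  then show ?thesis unfolding agiform_def by (intro poly_ring_closed) auto
qed

theorem corollary45:
  shows "(\<exists>p :: nat \<Rightarrow> rpoly. \<forall>m\<ge>1.
            p m \<in> poly_ring (block m 0 \<union> block m 1) \<and>
            edge_rank m (p m) = 3 \<and>
            edge_sos_rank m (p m) = 2 \<and>
            ereal (log 2 (real m)) \<le> ereal_of_enat (edge_sep_rank m (p m)) \<and>
            edge_sep_rank m (p m) < \<infinity>) \<and>
         (\<exists>p :: nat \<Rightarrow> rpoly.
            (\<forall>m\<ge>1.
               p m \<in> poly_ring (block m 0 \<union> block m 1) \<and>
               edge_rank m (p m) = 3 \<and>
               edge_sos_rank m (p m) < \<infinity>) \<and>
            (\<lambda>m. edge_sos_rank m (p m)) \<longlonglongrightarrow> \<infinity>)"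
proof (intro conjI)
  \<comment> \<open>Taking \<open>2 ^ (m + 2)\<close> nodes bounds the separable rank below by
    \<open>m + 2\<close> and provides the three nodes needed for rank 3, also at
    \<open>m = 1\<close>.\<close>
  have "ereal (log 2 (real m)) \<le> ereal_of_enat (edge_sep_rank m (euclid_poly (2 ^ (m + 2))))"
    if "m \<ge> 1" for m
  proof -
    have "log 2 (real m) \<le> real (m + 2)"
    proof (rule log2_of_power_le)
      have "m < 2 ^ m" by (rule less_exp)
      also have "(2::nat) ^ m \<le> 2 ^ (m + 2)" by (rule power_increasing) auto
      finally show "m \<le> 2 ^ (m + 2)" by simp
    qed (use that in simp)
    then have "ereal (log 2 (real m)) \<le> ereal_of_enat (enat (m + 2))" by simp
    also have "\<dots> \<le> ereal_of_enat (edge_sep_rank m (euclid_poly (2 ^ (m + 2))))"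
      using edge_sep_rank_ge[OF off_diagonal_euclid_poly order_refl, of "m + 2" m]
      by (simp only: ereal_of_enat_le_iff)
    finally show ?thesis .
  qed
  moreover have "(2::nat) ^ (m + 2) \<ge> 3" "(2::nat) ^ (m + 2) \<ge> 2" for m
  proof -
    have "(2::nat) ^ 2 \<le> 2 ^ (m + 2)" by (rule power_increasing) auto
    then have "4 \<le> (2::nat) ^ (m + 2)" by simp
    then show "(2::nat) ^ (m + 2) \<ge> 3" "(2::nat) ^ (m + 2) \<ge> 2"
      by (rule order_trans[rotated], simp)+
  qed
  ultimately show "\<exists>p :: nat \<Rightarrow> rpoly. \<forall>m\<ge>1.
            p m \<in> poly_ring (block m 0 \<union> block m 1) \<and>
            edge_rank m (p m) = 3 \<and>
            edge_sos_rank m (p m) = 2 \<and>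
            ereal (log 2 (real m)) \<le> ereal_of_enat (edge_sep_rank m (p m)) \<and>
            edge_sep_rank m (p m) < \<infinity>"
    by (intro exI[of _ "\<lambda>m. euclid_poly (2 ^ (m + 2))"] allI impI conjI
        euclid_poly_in_poly_ring edge_rank_euclid_poly edge_sos_rank_euclid_poly
        edge_sep_rank_euclid_poly_finite) auto
  have "(\<lambda>m. edge_sos_rank m (agiform (2 ^ m))) \<longlonglongrightarrow> \<infinity>"
  proof (rule order_tendstoI)
    fix a :: enat assume "a < \<infinity>"
    then obtain n where n: "a = enat n" by auto
    \<comment> \<open>The bound for degree \<open>2 ^ m\<close> is \<open>m - 1\<close>, since the
      squared polynomials have half the degree.\<close>
    have "a < edge_sos_rank m (agiform (2 ^ m))" if "m \<ge> n + 2" for m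
    proof -
      have "a < enat (m - 1)" using that by (simp add: n)
      also have "\<dots> \<le> edge_sos_rank m (agiform (2 ^ m))"
        using edge_sos_rank_agiform_ge[of "m - 1" m] that by simp
      finally show ?thesis .
    qed
    then show "\<forall>\<^sub>F m in sequentially. a < edge_sos_rank m (agiform (2 ^ m))"
      unfolding eventually_sequentially by blast
  qed simp
  moreover have "even ((2::nat) ^ m)" "(2::nat) ^ m \<ge> 2" if "m \<ge> 1" for m
    using that self_le_power[of "2::nat" m] by auto
  ultimately show "\<exists>p :: nat \<Rightarrow> rpoly.
            (\<forall>m\<ge>1.
               p m \<in> poly_ring (block m 0 \<union> block m 1) \<and>
               edge_rank m (p m) = 3 \<and>
               edge_sos_rank m (p m) < \<infinity>) \<and>
            (\<lambda>m. edge_sos_rank m (p m)) \<longlonglongrightarrow> \<infinity>"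
    by (intro exI[of _ "\<lambda>m. agiform (2 ^ m)"] allI impI conjI
        agiform_in_poly_ring edge_rank_agiform edge_sos_rank_agiform_finite) auto
qed

end
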